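(* Let $T>0$, $\varepsilon>0$, and let $K_\varepsilon(w)=r_{[0,T]}(\eta_\varepsilon*w)$ for $w\in L^1(0,T)$. Then $K_\varepsilon:L^1(0,T)\to L^2(0,T)$ is a bounded linear operator. Moreover, if $j:L^2(0,T)\to\mathbb{R}$ is twice Fréchet differentiable and there is $C>0$ such that $$|\nabla^2 j(w)(\psi,\phi)|\le C\|\psi\|_{L^2(0,T)}\|\phi\|_{L^2(0,T)}\quad\text{for all } w,\psi,\phi\in L^2(0,T),$$ then $j_\varepsilon:=j\circ K_\varepsilon:L^2(0,T)\to\mathbb{R}$ is twice Fréchet differentiable and there is a constant $C_\varepsilon>0$ (depending on $\varepsilon$) such that $$|\nabla^2 j_\varepsilon(w)(\psi,\phi)|\le C_\varepsilon\|\psi\|_{L^1(0,T)}\|\phi\|_{L^1(0,T)}\quad\text{for all } w,\psi,\phi\in L^2(0,T).$$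
   Context: $(\eta_\varepsilon)_{\varepsilon>0}$ is a family of positive mollifiers: $\eta_\varepsilon(t)=\varepsilon^{-1}\eta(t/\varepsilon)$ with the usual kernel $\eta\in C_c^\infty(\mathbb{R})$, $\eta\ge 0$, $\int_{\mathbb{R}}\eta=1$, $\operatorname{supp}\eta\subset[-1,1]$. In $\eta_\varepsilon*w$ the function $w\in L^1(0,T)$ is extended by $0$ outside $[0,T]$; $r_{[0,T]}$ denotes restriction of a function on $\mathbb{R}$ to $[0,T]$. *)

theory Defs
  imports "HOL-Analysis.Analysis"
begin

text \<open>
  The types \<open>L1\<close> and \<open>L2\<close> are the spaces of almost-everywhere classes of real functions on
  \<open>\<real>\<close>. Since types cannot depend on the number \<open>T\<close>, the spaces \<open>L\<^sup>1(0,T)\<close> and \<open>L\<^sup>2(0,T)\<close> are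
  the closed subspaces \<open>L1_on T\<close> and \<open>L2_on T\<close> of classes vanishing almost everywhere outside
  \<open>[0,T]\<close>, i.e. functions on \<open>(0,T)\<close> are identified isometrically with their extensions by \<open>0\<close>.
\<close>

section \<open>The space \<open>L\<^sup>1(\<real>)\<close>\<close>

definition L1_rel :: "(real \<Rightarrow> real) \<Rightarrow> (real \<Rightarrow> real) \<Rightarrow> bool" where
  "L1_rel f g \<longleftrightarrow> integrable lborel f \<and> integrable lborel g \<and> (AE t in lborel. f t = g t)"

lemma part_equivp_L1_rel: "part_equivp L1_rel"
proof (rule part_equivpI)
  show "\<exists>f. L1_rel f f"
    by (rule exI[of _ "\<lambda>_. 0"]) (simp add: L1_rel_def)
  show "symp L1_rel"
    by (auto simp: symp_def L1_rel_def)
  show "transp L1_rel"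
    unfolding transp_def L1_rel_def by (auto elim: eventually_elim2)
qed

quotient_type L1 = "real \<Rightarrow> real" / partial: L1_rel
  morphisms rep_L1 L1_class
  by (rule part_equivp_L1_rel)

instantiation L1 :: real_normed_vector
begin

lift_definition zero_L1 :: L1 is "\<lambda>_. 0"
  by (simp add: L1_rel_def)

lift_definition plus_L1 :: "L1 \<Rightarrow> L1 \<Rightarrow> L1" is "\<lambda>f g t. f t + g t"
  unfolding L1_rel_def by (auto elim: eventually_elim2)

lift_definition uminus_L1 :: "L1 \<Rightarrow> L1" is "\<lambda>f t. - f t"
  unfolding L1_rel_def by auto

lift_definition minus_L1 :: "L1 \<Rightarrow> L1 \<Rightarrow> L1" is "\<lambda>f g t. f t - g t"
  unfolding L1_rel_def by (auto elim: eventually_elim2)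

lift_definition scaleR_L1 :: "real \<Rightarrow> L1 \<Rightarrow> L1" is "\<lambda>c f t. c * f t"
  unfolding L1_rel_def by auto

lift_definition norm_L1 :: "L1 \<Rightarrow> real" is "\<lambda>f. \<integral>t. \<bar>f t\<bar> \<partial>lborel"
  unfolding L1_rel_def by (intro integral_cong_AE) auto

definition dist_L1 :: "L1 \<Rightarrow> L1 \<Rightarrow> real" where
  "dist_L1 v w = norm (v - w)"

definition sgn_L1 :: "L1 \<Rightarrow> L1" where
  "sgn_L1 w = scaleR (inverse (norm w)) w"

definition uniformity_L1 :: "(L1 \<times> L1) filter" where
  "uniformity_L1 = (INF e\<in>{0 <..}. principal {(v, w). dist v w < e})"

definition open_L1 :: "L1 set \<Rightarrow> bool" where
  "open_L1 S = (\<forall>v\<in>S. \<forall>\<^sub>F (v', w) in uniformity. v' = v \<longrightarrow> w \<in> S)"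

instance
proof
  fix a b c :: L1 and r s :: real
  show "a + b + c = a + (b + c)"
    by transfer (auto simp: L1_rel_def add.assoc)
  show "a + b = b + a"
    by transfer (auto simp: L1_rel_def add.commute)
  show "0 + a = a"
    by transfer (auto simp: L1_rel_def)
  show "- a + a = 0"
    by transfer (auto simp: L1_rel_def)
  show "a - b = a + - b"
    by transfer (auto simp: L1_rel_def)
  show "r *\<^sub>R (a + b) = r *\<^sub>R a + r *\<^sub>R b"
    by transfer (auto simp: L1_rel_def distrib_left)
  show "(r + s) *\<^sub>R a = r *\<^sub>R a + s *\<^sub>R a"
    by transfer (auto simp: L1_rel_def distrib_right)
  show "r *\<^sub>R s *\<^sub>R a = (r * s) *\<^sub>R a"
    by transfer (auto simp: L1_rel_def mult.assoc)
  show "1 *\<^sub>R a = a"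
    by transfer (auto simp: L1_rel_def)
  show "norm a = 0 \<longleftrightarrow> a = 0"
    by transfer (auto simp: L1_rel_def integral_nonneg_eq_0_iff_AE)
  show "norm (a + b) \<le> norm a + norm b"
  proof transfer
    fix f g assume "L1_rel f f" "L1_rel g g"
    then have f: "integrable lborel f" and g: "integrable lborel g"
      by (auto simp: L1_rel_def)
    have "(\<integral>t. \<bar>f t + g t\<bar> \<partial>lborel) \<le> (\<integral>t. \<bar>f t\<bar> + \<bar>g t\<bar> \<partial>lborel)"
      using f g by (intro integral_mono) auto
    also have "\<dots> = (\<integral>t. \<bar>f t\<bar> \<partial>lborel) + (\<integral>t. \<bar>g t\<bar> \<partial>lborel)"
      using f g by simp
    finally show "(\<integral>t. \<bar>f t + g t\<bar> \<partial>lborel) \<le> (\<integral>t. \<bar>f t\<bar> \<partial>lborel) + (\<integral>t. \<bar>g t\<bar> \<partial>lborel)" .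
  qed
  show "norm (r *\<^sub>R a) = \<bar>r\<bar> * norm a"
    by transfer (auto simp: L1_rel_def abs_mult)
qed (auto simp: dist_L1_def sgn_L1_def uniformity_L1_def open_L1_def)

end

section \<open>The space \<open>L\<^sup>2(\<real>)\<close>\<close>

definition square_integrable :: "(real \<Rightarrow> real) \<Rightarrow> bool" where
  "square_integrable f \<longleftrightarrow> f \<in> borel_measurable lborel \<and> integrable lborel (\<lambda>t. (f t)\<^sup>2)"

lemma square_integrable_mult:
  assumes "square_integrable f" "square_integrable g"
  shows "integrable lborel (\<lambda>t. f t * g t)"
proof (rule Bochner_Integration.integrable_bound)
  show "integrable lborel (\<lambda>t. (f t)\<^sup>2 + (g t)\<^sup>2)"
    using assms by (simp add: square_integrable_def)
  show "(\<lambda>t. f t * g t) \<in> borel_measurable lborel"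
    using assms by (auto simp: square_integrable_def)
  show "AE t in lborel. norm (f t * g t) \<le> norm ((f t)\<^sup>2 + (g t)\<^sup>2)"
  proof (rule AE_I2)
    fix t
    have "2 * \<bar>f t * g t\<bar> \<le> (f t)\<^sup>2 + (g t)\<^sup>2"
      using sum_squares_bound[of "\<bar>f t\<bar>" "\<bar>g t\<bar>"] by (simp add: abs_mult)
    then show "norm (f t * g t) \<le> norm ((f t)\<^sup>2 + (g t)\<^sup>2)"
      unfolding real_norm_def using abs_ge_zero[of "f t * g t"] by linarith
  qed
qed

lemma square_integrable_zero: "square_integrable (\<lambda>_. 0)"
  by (simp add: square_integrable_def)

lemma square_integrable_cmult:
  "square_integrable f \<Longrightarrow> square_integrable (\<lambda>t. c * f t)"
  by (auto simp: square_integrable_def power_mult_distrib)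

lemma square_integrable_add:
  assumes "square_integrable f" "square_integrable g"
  shows "square_integrable (\<lambda>t. f t + g t)"
  using assms square_integrable_mult[OF assms]
  by (auto simp: square_integrable_def power2_sum mult.assoc)

lemma square_integrable_uminus:
  "square_integrable f \<Longrightarrow> square_integrable (\<lambda>t. - f t)"
  by (auto simp: square_integrable_def)

lemma square_integrable_diff:
  assumes "square_integrable f" "square_integrable g"
  shows "square_integrable (\<lambda>t. f t - g t)"
  using square_integrable_add[OF assms(1) square_integrable_uminus[OF assms(2)]] by simp

definition L2_rel :: "(real \<Rightarrow> real) \<Rightarrow> (real \<Rightarrow> real) \<Rightarrow> bool" where
  "L2_rel f g \<longleftrightarrow> square_integrable f \<and> square_integrable g \<and> (AE t in lborel. f t = g t)"

lemma part_equivp_L2_rel: "part_equivp L2_rel"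
proof (rule part_equivpI)
  show "\<exists>f. L2_rel f f"
    by (rule exI[of _ "\<lambda>_. 0"]) (simp add: L2_rel_def square_integrable_zero)
  show "symp L2_rel"
    by (auto simp: symp_def L2_rel_def)
  show "transp L2_rel"
    unfolding transp_def L2_rel_def by (auto elim: eventually_elim2)
qed

quotient_type L2 = "real \<Rightarrow> real" / partial: L2_rel
  morphisms rep_L2 L2_class
  by (rule part_equivp_L2_rel)

instantiation L2 :: real_inner
begin

lift_definition zero_L2 :: L2 is "\<lambda>_. 0"
  by (simp add: L2_rel_def square_integrable_zero)

lift_definition plus_L2 :: "L2 \<Rightarrow> L2 \<Rightarrow> L2" is "\<lambda>f g t. f t + g t"
  unfolding L2_rel_def by (auto elim: eventually_elim2 intro: square_integrable_add)

lift_definition uminus_L2 :: "L2 \<Rightarrow> L2" is "\<lambda>f t. - f t"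
  unfolding L2_rel_def by (auto intro: square_integrable_uminus)

lift_definition minus_L2 :: "L2 \<Rightarrow> L2 \<Rightarrow> L2" is "\<lambda>f g t. f t - g t"
  unfolding L2_rel_def by (auto elim: eventually_elim2 intro: square_integrable_diff)

lift_definition scaleR_L2 :: "real \<Rightarrow> L2 \<Rightarrow> L2" is "\<lambda>c f t. c * f t"
  unfolding L2_rel_def by (auto intro: square_integrable_cmult)

lift_definition inner_L2 :: "L2 \<Rightarrow> L2 \<Rightarrow> real" is "\<lambda>f g. \<integral>t. f t * g t \<partial>lborel"
  unfolding L2_rel_def
  by (intro integral_cong_AE) (auto simp: square_integrable_def elim: eventually_elim2)

lift_definition norm_L2 :: "L2 \<Rightarrow> real" is "\<lambda>f. sqrt (\<integral>t. (f t)\<^sup>2 \<partial>lborel)"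
  unfolding L2_rel_def
  by (intro arg_cong[where f = sqrt] integral_cong_AE) (auto simp: square_integrable_def)

definition dist_L2 :: "L2 \<Rightarrow> L2 \<Rightarrow> real" where
  "dist_L2 v w = norm (v - w)"

definition sgn_L2 :: "L2 \<Rightarrow> L2" where
  "sgn_L2 w = scaleR (inverse (norm w)) w"

definition uniformity_L2 :: "(L2 \<times> L2) filter" where
  "uniformity_L2 = (INF e\<in>{0 <..}. principal {(v, w). dist v w < e})"

definition open_L2 :: "L2 set \<Rightarrow> bool" where
  "open_L2 S = (\<forall>v\<in>S. \<forall>\<^sub>F (v', w) in uniformity. v' = v \<longrightarrow> w \<in> S)"

instance
proof
  fix a b c :: L2 and r s :: real
  show "a + b + c = a + (b + c)"
    by transfer (auto simp: L2_rel_def add.assoc intro!: square_integrable_add)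
  show "a + b = b + a"
    by transfer (auto simp: L2_rel_def add.commute intro!: square_integrable_add)
  show "0 + a = a"
    by transfer (auto simp: L2_rel_def)
  show "- a + a = 0"
    by transfer (auto simp: L2_rel_def square_integrable_zero)
  show "a - b = a + - b"
    by transfer (auto simp: L2_rel_def intro!: square_integrable_diff)
  show "r *\<^sub>R (a + b) = r *\<^sub>R a + r *\<^sub>R b"
    by transfer (auto simp: L2_rel_def distrib_left
      intro!: square_integrable_add square_integrable_cmult)
  show "(r + s) *\<^sub>R a = r *\<^sub>R a + s *\<^sub>R a"
    by transfer (auto simp: L2_rel_def distrib_right
      intro!: square_integrable_add square_integrable_cmult)
  show "r *\<^sub>R s *\<^sub>R a = (r * s) *\<^sub>R a"
    by transfer (auto simp: L2_rel_def mult.assoc intro!: square_integrable_cmult)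
  show "1 *\<^sub>R a = a"
    by transfer (auto simp: L2_rel_def)
  show "inner a b = inner b a"
    by transfer (simp add: mult.commute)
  show "inner (a + b) c = inner a c + inner b c"
    by transfer (simp add: L2_rel_def distrib_right square_integrable_mult)
  show "inner (r *\<^sub>R a) b = r * inner a b"
    by transfer (simp add: L2_rel_def mult.assoc)
  show "0 \<le> inner a a"
    by transfer simp
  show "inner a a = 0 \<longleftrightarrow> a = 0"
    by transfer (auto simp: L2_rel_def square_integrable_zero square_integrable_mult
      integral_nonneg_eq_0_iff_AE)
  show "norm a = sqrt (inner a a)"
    by transfer (simp add: power2_eq_square)
qed (auto simp: dist_L2_def sgn_L2_def uniformity_L2_def open_L2_def)

end

section \<open>The spaces \<open>L\<^sup>1(0,T)\<close> and \<open>L\<^sup>2(0,T)\<close>\<close>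

definition L1_on :: "real \<Rightarrow> L1 set" where
  "L1_on T = {w. AE t in lborel. t \<notin> {0..T} \<longrightarrow> rep_L1 w t = 0}"

definition L2_on :: "real \<Rightarrow> L2 set" where
  "L2_on T = {w. AE t in lborel. t \<notin> {0..T} \<longrightarrow> rep_L2 w t = 0}"

definition truncate :: "real \<Rightarrow> (real \<Rightarrow> real) \<Rightarrow> real \<Rightarrow> real" where
  "truncate T f = (\<lambda>t. indicator {0..T} t * f t)"

text \<open>The inclusion of \<open>L\<^sup>2(0,T)\<close> into \<open>L\<^sup>1(0,T)\<close>. The truncation has no effect on \<open>L2_on T\<close>.\<close>

definition L2_to_L1 :: "real \<Rightarrow> L2 \<Rightarrow> L1" where
  "L2_to_L1 T w = L1_class (truncate T (rep_L2 w))"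

section \<open>Mollification\<close>

definition mollifier_kernel :: "(real \<Rightarrow> real) \<Rightarrow> bool" where
  "mollifier_kernel \<eta> \<longleftrightarrow>
     (\<forall>n. (deriv ^^ n) \<eta> differentiable_on UNIV) \<and>
     (\<forall>t. 0 \<le> \<eta> t) \<and>
     closure {t. \<eta> t \<noteq> 0} \<subseteq> {-1..1} \<and>
     (\<integral>t. \<eta> t \<partial>lborel) = 1"

definition mollifier :: "(real \<Rightarrow> real) \<Rightarrow> real \<Rightarrow> real \<Rightarrow> real" where
  "mollifier \<eta> \<epsilon> t = \<eta> (t / \<epsilon>) / \<epsilon>"

definition convolution :: "(real \<Rightarrow> real) \<Rightarrow> (real \<Rightarrow> real) \<Rightarrow> real \<Rightarrow> real" where
  "convolution f g t = (\<integral>s. f (t - s) * g s \<partial>lborel)"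

text \<open>
  The inner truncation is the extension of a function on \<open>[0,T]\<close> by \<open>0\<close>. On \<open>L1_on T\<close> it has no
  effect. Because of it \<open>mollify \<eta> \<epsilon> T\<close> sends the classes that vanish on \<open>[0,T]\<close> to \<open>0\<close>, so
  boundedness on the type \<open>L1\<close> is the same as boundedness on \<open>L1_on T\<close>.
\<close>

definition mollify_fun :: "(real \<Rightarrow> real) \<Rightarrow> real \<Rightarrow> real \<Rightarrow> (real \<Rightarrow> real) \<Rightarrow> real \<Rightarrow> real" where
  "mollify_fun \<eta> \<epsilon> T f = truncate T (convolution (mollifier \<eta> \<epsilon>) (truncate T f))"

definition mollify :: "(real \<Rightarrow> real) \<Rightarrow> real \<Rightarrow> real \<Rightarrow> L1 \<Rightarrow> L2" where
  "mollify \<eta> \<epsilon> T w = L2_class (mollify_fun \<eta> \<epsilon> T (rep_L1 w))"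

section \<open>Second Frechet derivatives on a subspace\<close>

text \<open>
  \<open>H w\<close> is the second Frechet derivative of \<open>j\<close>, as a function on the linear subspace \<open>S\<close>, at
  every \<open>w \<in> S\<close>. The derivatives take values in the dual of the whole type, so \<open>G w\<close> and \<open>H w\<close>
  are determined only on \<open>S\<close> and on \<open>S \<times> S\<close>. If there is a bounded projection \<open>P\<close> onto \<open>S\<close>, as
  there is for \<open>L2_on T\<close>, then composing with \<open>P\<close> turns derivatives with values in the dual of \<open>S\<close>
  into such \<open>G\<close> and \<open>H\<close>, so nothing is lost by this.
\<close>

definition has_second_derivative_on ::
  "('a::real_normed_vector \<Rightarrow> real) \<Rightarrow> ('a \<Rightarrow> 'a \<Rightarrow>\<^sub>L 'a \<Rightarrow>\<^sub>L real) \<Rightarrow> 'a set \<Rightarrow> bool" where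
  "has_second_derivative_on j H S \<longleftrightarrow>
     (\<exists>G :: 'a \<Rightarrow> 'a \<Rightarrow>\<^sub>L real. \<forall>w\<in>S.
        (j has_derivative blinfun_apply (G w)) (at w within S) \<and>
        (G has_derivative blinfun_apply (H w)) (at w within S))"

end

theory Submission
  imports Defs
begin

text \<open>
  The kernel is bounded, so the mollification is bounded uniformly by a multiple of the \<open>L\<^sup>1\<close> norm and
  is supported in \<open>[0,T]\<close>: this bounds \<open>K\<^sub>\<epsilon>\<close> from \<open>L\<^sup>1\<close> to \<open>L\<^sup>2\<close>. On \<open>L\<^sup>2(0,T)\<close> it is composed with the
  inclusion into \<open>L\<^sup>1(0,T)\<close>, so \<open>j\<^sub>\<epsilon>\<close> is \<open>j\<close> after a bounded linear map and the chain rule gives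
  \<open>\<nabla>\<^sup>2j\<^sub>\<epsilon>(w)(\<psi>,\<phi>) = \<nabla>\<^sup>2j(K\<^sub>\<epsilon>w)(K\<^sub>\<epsilon>\<psi>,K\<^sub>\<epsilon>\<phi>)\<close>; hence \<open>C\<^sub>\<epsilon> = C\<parallel>K\<^sub>\<epsilon>\<parallel>\<^sup>2\<close>.
\<close>

section \<open>Classes and their chosen representatives in \<open>L1\<close> and
  \<open>L2\<close>\<close>

lemma L1_rel_refl_iff: "L1_rel f f \<longleftrightarrow> integrable lborel f"
  by (simp add: L1_rel_def)

lemma L2_rel_refl_iff: "L2_rel f f \<longleftrightarrow> square_integrable f"
  by (simp add: L2_rel_def)

lemma integrable_rep_L1: "integrable lborel (rep_L1 w)"
  using Quotient3_rep_reflp[OF Quotient3_L1, of w] by (simp add: L1_rel_refl_iff)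

lemma square_integrable_rep_L2: "square_integrable (rep_L2 w)"
  using Quotient3_rep_reflp[OF Quotient3_L2, of w] by (simp add: L2_rel_refl_iff)

lemma L1_class_rep: "L1_class (rep_L1 w) = w"
  by (rule Quotient3_abs_rep[OF Quotient3_L1])

lemma L2_class_rep: "L2_class (rep_L2 w) = w"
  by (rule Quotient3_abs_rep[OF Quotient3_L2])

lemma rep_L1_class:
  assumes "integrable lborel f"
  shows "AE t in lborel. rep_L1 (L1_class f) t = f t"
  using rep_abs_rsp_left[OF Quotient3_L1, of f f] assms by (simp add: L1_rel_def)

lemma rep_L2_class:
  assumes "square_integrable f"
  shows "AE t in lborel. rep_L2 (L2_class f) t = f t"
  using rep_abs_rsp_left[OF Quotient3_L2, of f f] assms by (simp add: L2_rel_def)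

lemma L1_class_eqI:
  assumes "integrable lborel f" "integrable lborel g" "AE t in lborel. f t = g t"
  shows "L1_class f = L1_class g"
  using Quotient3_rel_abs[OF Quotient3_L1, of f g] assms by (simp add: L1_rel_def)

lemma L1_class_add:
  assumes "integrable lborel f" "integrable lborel g"
  shows "L1_class (\<lambda>t. f t + g t) = L1_class f + L1_class g"
  using plus_L1.abs_eq[of f g] assms by (simp add: L1_rel_refl_iff)

lemma L1_class_scaleR:
  assumes "integrable lborel f"
  shows "L1_class (\<lambda>t. c * f t) = c *\<^sub>R L1_class f"
  using scaleR_L1.abs_eq[of f c] assms by (simp add: L1_rel_refl_iff)

lemma norm_L1_class:
  assumes "integrable lborel f"
  shows "norm (L1_class f) = (\<integral>t. \<bar>f t\<bar> \<partial>lborel)"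
  using norm_L1.abs_eq[of f] assms by (simp add: L1_rel_refl_iff)

lemma L2_class_add:
  assumes "square_integrable f" "square_integrable g"
  shows "L2_class (\<lambda>t. f t + g t) = L2_class f + L2_class g"
  using plus_L2.abs_eq[of f g] assms by (simp add: L2_rel_refl_iff)

lemma L2_class_scaleR:
  assumes "square_integrable f"
  shows "L2_class (\<lambda>t. c * f t) = c *\<^sub>R L2_class f"
  using scaleR_L2.abs_eq[of f c] assms by (simp add: L2_rel_refl_iff)

lemma norm_L2_class:
  assumes "square_integrable f"
  shows "norm (L2_class f) = sqrt (\<integral>t. (f t)\<^sup>2 \<partial>lborel)"
  using norm_L2.abs_eq[of f] assms by (simp add: L2_rel_refl_iff)

lemma inner_L2_class:
  assumes "square_integrable f" "square_integrable g"
  shows "inner (L2_class f) (L2_class g) = (\<integral>t. f t * g t \<partial>lborel)"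
  using inner_L2.abs_eq[of f g] assms by (simp add: L2_rel_refl_iff)

text \<open>\<open>rep_L1\<close> chooses one representative per class, so it respects sums only
  almost everywhere: both sides represent the class \<open>v + w\<close>, and
  \<open>rep_L1_class\<close> compares them.\<close>

lemma rep_L1_add: "AE t in lborel. rep_L1 (v + w) t = rep_L1 v t + rep_L1 w t"
  using rep_L1_class[OF Bochner_Integration.integrable_add[OF integrable_rep_L1 integrable_rep_L1]]
  by (simp add: L1_class_add integrable_rep_L1 L1_class_rep)

lemma rep_L1_scaleR: "AE t in lborel. rep_L1 (c *\<^sub>R w) t = c * rep_L1 w t"
  using rep_L1_class[OF integrable_mult_right[OF integrable_rep_L1]]
  by (simp add: L1_class_scaleR integrable_rep_L1 L1_class_rep)

lemma rep_L2_add: "AE t in lborel. rep_L2 (v + w) t = rep_L2 v t + rep_L2 w t"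
  using rep_L2_class[OF square_integrable_add[OF square_integrable_rep_L2 square_integrable_rep_L2]]
  by (simp add: L2_class_add square_integrable_rep_L2 L2_class_rep)

lemma rep_L2_scaleR: "AE t in lborel. rep_L2 (c *\<^sub>R w) t = c * rep_L2 w t"
  using rep_L2_class[OF square_integrable_cmult[OF square_integrable_rep_L2]]
  by (simp add: L2_class_scaleR square_integrable_rep_L2 L2_class_rep)

lemma norm_L1_rep: "norm w = (\<integral>t. \<bar>rep_L1 w t\<bar> \<partial>lborel)"
  by (metis norm_L1_class integrable_rep_L1 L1_class_rep)

section \<open>Truncation to the interval and the inclusion of square-integrable into integrable
  functions\<close>

lemma integrable_truncate:
  "integrable lborel f \<Longrightarrow> integrable lborel (truncate T f)"
  unfolding truncate_def using integrable_mult_indicator[of "{0..T}" lborel f] by simp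

lemma integrable_indicator_Icc: "integrable lborel (indicator {a..b::real} :: real \<Rightarrow> real)"
  by (intro integrable_real_indicator) (auto simp: emeasure_lborel_Icc_eq)

lemma square_integrable_indicator: "square_integrable (indicator {a..b})"
  by (simp add: square_integrable_def power2_eq_square integrable_indicator_Icc
      flip: indicator_inter_arith)

lemma square_integrable_abs:
  "square_integrable f \<Longrightarrow> square_integrable (\<lambda>t. \<bar>f t\<bar>)"
  by (auto simp: square_integrable_def intro: borel_measurable_abs)

lemma integrable_truncate_square_integrable:
  "square_integrable f \<Longrightarrow> integrable lborel (truncate T f)"
  unfolding truncate_def by (intro square_integrable_mult square_integrable_indicator)

text \<open>Cauchy-Schwarz against the indicator of the interval, whose \<open>L2\<close> norm is
  the source of the factor \<open>sqrt T\<close>. The truncation in \<open>L2_to_L1\<close> makes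
  the estimate valid on the whole type \<open>L2\<close>, as \<open>bounded_linear\<close>
  requires.\<close>

lemma norm_L2_to_L1_le:
  assumes "T \<ge> 0"
  shows "norm (L2_to_L1 T w) \<le> sqrt T * norm w"
proof -
  let ?f = "rep_L2 w" and ?i = "indicator {0..T} :: real \<Rightarrow> real"
  note si = square_integrable_rep_L2[of w] square_integrable_abs[OF square_integrable_rep_L2[of w]]
    square_integrable_indicator[of 0 T]
  have "norm (L2_to_L1 T w) = (\<integral>t. ?i t * \<bar>?f t\<bar> \<partial>lborel)"
    unfolding L2_to_L1_def
    by (subst norm_L1_class[OF integrable_truncate_square_integrable[OF si(1)]])
      (simp add: truncate_def abs_mult)
  also have "\<dots> = inner (L2_class ?i) (L2_class (\<lambda>t. \<bar>?f t\<bar>))"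
    by (simp add: inner_L2_class si)
  also have "\<dots> \<le> norm (L2_class ?i) * norm (L2_class (\<lambda>t. \<bar>?f t\<bar>))"
    by (rule norm_cauchy_schwarz)
  \<comment> \<open>Squaring removes the absolute value, so this class has the same norm as
    \<open>w\<close>.\<close>
  also have "norm (L2_class (\<lambda>t. \<bar>?f t\<bar>)) = norm w"
    using norm_L2_class[OF si(1)] by (simp add: norm_L2_class si L2_class_rep)
  also have "norm (L2_class ?i) = sqrt T"
    using assms
    by (simp add: norm_L2_class si power2_eq_square flip: indicator_inter_arith)
  finally show ?thesis .
qed

lemma bounded_linear_L2_to_L1:
  assumes "T \<ge> 0"
  shows "bounded_linear (L2_to_L1 T)"
proof (rule bounded_linear_intro[where K = "sqrt T"])
  note [simp] = integrable_truncate_square_integrable square_integrable_rep_L2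
  show "L2_to_L1 T (v + w) = L2_to_L1 T v + L2_to_L1 T w" for v w
  proof -
    have "L1_class (truncate T (rep_L2 (v + w)))
      = L1_class (\<lambda>t. truncate T (rep_L2 v) t + truncate T (rep_L2 w) t)"
      using rep_L2_add[of v w]
      by (intro L1_class_eqI Bochner_Integration.integrable_add integrable_truncate_square_integrable)
        (auto simp: truncate_def distrib_left elim: eventually_mono)
    then show ?thesis
      by (simp add: L2_to_L1_def L1_class_add)
  qed
  show "L2_to_L1 T (c *\<^sub>R w) = c *\<^sub>R L2_to_L1 T w" for c w
  proof -
    have "L1_class (truncate T (rep_L2 (c *\<^sub>R w)))
      = L1_class (\<lambda>t. c * truncate T (rep_L2 w) t)"
      using rep_L2_scaleR[of c w]
      by (intro L1_class_eqI integrable_mult_right integrable_truncate_square_integrable)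
        (auto simp: truncate_def elim: eventually_mono)
    then show ?thesis
      by (simp add: L2_to_L1_def L1_class_scaleR)
  qed
  show "norm (L2_to_L1 T w) \<le> norm w * sqrt T" for w
    using norm_L2_to_L1_le[OF assms, of w] by (simp add: mult.commute)
qed

section \<open>Measurability and boundedness of the unscaled kernel\<close>

lemma mollifier_kernel_measurable:
  assumes "mollifier_kernel \<eta>"
  shows "\<eta> \<in> borel_measurable borel"
proof -
  \<comment> \<open>This is the instance n = 0 of the smoothness condition on iterated
    derivatives.\<close>
  have "\<eta> differentiable_on UNIV"
    using assms unfolding mollifier_kernel_def by (metis funpow_0)
  then show ?thesis
    by (intro borel_measurable_continuous_onI differentiable_imp_continuous_on)
qed

text \<open>Continuity bounds the kernel on the compact interval \<open>{-1..1}\<close>, and outside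
  it the support condition makes the kernel vanish.\<close>

lemma mollifier_kernel_bounded:
  assumes "mollifier_kernel \<eta>"
  shows "\<exists>M. \<forall>t. \<bar>\<eta> t\<bar> \<le> M"
proof -
  have "\<eta> differentiable_on UNIV"
    using assms unfolding mollifier_kernel_def by (metis funpow_0)
  then have "compact (\<eta> ` {-1..1})"
    by (intro compact_continuous_image continuous_on_subset[OF differentiable_imp_continuous_on]) auto
  then have "bounded (\<eta> ` {-1..1})"
    by (rule compact_imp_bounded)
  then obtain M where M: "M > 0" "\<And>t. t \<in> {-1..1} \<Longrightarrow> \<bar>\<eta> t\<bar> \<le> M"
    by (auto simp: bounded_pos)
  have "\<bar>\<eta> t\<bar> \<le> M" for t
  proof (cases "\<eta> t = 0")
    case False
    then have "t \<in> closure {t. \<eta> t \<noteq> 0}"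
      by (intro subsetD[OF closure_subset]) simp
    moreover have "closure {t. \<eta> t \<noteq> 0} \<subseteq> {-1..1}"
      using assms by (simp add: mollifier_kernel_def)
    ultimately show ?thesis
      using M(2) by blast
  qed (use M in simp)
  then show ?thesis by blast
qed

section \<open>Convolution with a bounded measurable kernel\<close>

context
  fixes k :: "real \<Rightarrow> real" and M :: real
  assumes k_meas: "k \<in> borel_measurable borel"
    and k_bound: "\<And>t. \<bar>k t\<bar> \<le> M"
begin

lemma convolution_integrable:
  assumes "integrable lborel f"
  shows "integrable lborel (\<lambda>s. k (t - s) * f s)"
proof (rule Bochner_Integration.integrable_bound)
  show "integrable lborel (\<lambda>s. M * f s)"
    using assms by simp
  show "(\<lambda>s. k (t - s) * f s) \<in> borel_measurable lborel"
    using assms k_meas by measurable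
  show "AE s in lborel. norm (k (t - s) * f s) \<le> norm (M * f s)"
    \<comment> \<open>The norm of the majorant contains \<open>\<bar>M\<bar>\<close>, so the bound
      on \<open>k\<close> is first weakened from \<open>M\<close> to
      \<open>\<bar>M\<bar>\<close>.\<close>
    using order_trans[OF k_bound abs_ge_self]
    by (intro AE_I2) (auto simp: abs_mult intro!: mult_right_mono)
qed

text \<open>The case of Young's inequality from the integral norm to the supremum norm. Its
  uniformity in \<open>t\<close> is what gives a square-integral bound on a bounded
  interval.\<close>

lemma convolution_bound:
  assumes "integrable lborel f"
  shows "\<bar>convolution k f t\<bar> \<le> M * (\<integral>s. \<bar>f s\<bar> \<partial>lborel)"
proof -
  have "\<bar>convolution k f t\<bar> \<le> (\<integral>s. \<bar>k (t - s) * f s\<bar> \<partial>lborel)"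
    unfolding convolution_def by (rule integral_abs_bound)
  also have "\<dots> \<le> (\<integral>s. M * \<bar>f s\<bar> \<partial>lborel)"
    using assms k_bound
    by (intro integral_mono integrable_abs convolution_integrable integrable_mult_right)
      (auto simp: abs_mult intro!: mult_right_mono)
  finally show ?thesis by simp
qed

text \<open>The integrand is jointly measurable in \<open>t\<close> and \<open>s\<close>, and
  integrating out \<open>s\<close> over a sigma-finite measure preserves measurability in
  \<open>t\<close>.\<close>

lemma convolution_measurable:
  assumes "integrable lborel f"
  shows "convolution k f \<in> borel_measurable borel"
proof -
  have f: "f \<in> borel_measurable borel"
    using borel_measurable_integrable[OF assms] by simp
  have "(\<lambda>(t, s). k (t - s) * f s) \<in> borel_measurable (borel \<Otimes>\<^sub>M lborel)"
    using f k_meas by measurable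
  then show ?thesis
    unfolding convolution_def[abs_def]
    by (rule lborel.borel_measurable_lebesgue_integral)
qed

text \<open>After truncation the square of the convolution is dominated by a constant times the
  indicator of an interval of length \<open>T\<close>; integrating and taking the root gives the
  factor \<open>sqrt T\<close>.\<close>

lemma square_integrable_truncate_convolution:
  assumes "integrable lborel f" "T \<ge> 0"
  shows "square_integrable (truncate T (convolution k f))"
    and "norm (L2_class (truncate T (convolution k f))) \<le> sqrt T * M * (\<integral>s. \<bar>f s\<bar> \<partial>lborel)"
proof -
  let ?g = "truncate T (convolution k f)"
  define B where "B = M * (\<integral>s. \<bar>f s\<bar> \<partial>lborel)"
  \<comment> \<open>The sign matters at the end, where the square root of \<open>B\<^sup>2\<close>
    has to be \<open>B\<close> itself.\<close>
  have "M \<ge> 0"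
    using order_trans[OF abs_ge_zero k_bound] .
  then have B: "B \<ge> 0"
    by (simp add: B_def)
  have meas: "?g \<in> borel_measurable lborel"
    using convolution_measurable[OF assms(1)] unfolding truncate_def by measurable
  have le: "(?g t)\<^sup>2 \<le> B\<^sup>2 * indicator {0..T} t" for t
    using convolution_bound[OF assms(1), of t]
    by (auto simp: truncate_def indicator_def B_def[symmetric] abs_le_square_iff[symmetric])
  have int: "integrable lborel (\<lambda>t. B\<^sup>2 * indicator {0..T} t :: real)"
    by (intro integrable_mult_right integrable_indicator_Icc)
  have int_g: "integrable lborel (\<lambda>t. (?g t)\<^sup>2)"
    using int by (rule Bochner_Integration.integrable_bound)
      (use meas le in \<open>auto intro: order_trans[OF le]\<close>)
  show si: "square_integrable ?g"
    using meas int_g by (simp add: square_integrable_def)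
  have "norm (L2_class ?g) \<le> sqrt (\<integral>t. B\<^sup>2 * indicator {0..T} t \<partial>lborel)"
    unfolding norm_L2_class[OF si]
    using int int_g le by (intro real_sqrt_le_mono integral_mono) auto
  also have "\<dots> = sqrt T * B"
    using assms(2) B by (simp add: real_sqrt_mult)
  finally show "norm (L2_class ?g) \<le> sqrt T * M * (\<integral>s. \<bar>f s\<bar> \<partial>lborel)"
    by (simp add: B_def mult.assoc)
qed

end

section \<open>The mollification operator from \<open>L1\<close> to \<open>L2\<close>\<close>

lemma truncate_in_L2_on:
  assumes "square_integrable (truncate T f)"
  shows "L2_class (truncate T f) \<in> L2_on T"
  using rep_L2_class[OF assms]
  by (auto simp: L2_on_def truncate_def elim: eventually_mono)

context
  fixes \<eta> :: "real \<Rightarrow> real" and T \<epsilon> :: real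
  assumes \<eta>: "mollifier_kernel \<eta>" and T: "T \<ge> 0" and \<epsilon>: "\<epsilon> > 0"
begin

lemma mollifier_measurable: "mollifier \<eta> \<epsilon> \<in> borel_measurable borel"
  using mollifier_kernel_measurable[OF \<eta>] unfolding mollifier_def[abs_def] by measurable

text \<open>Rescaling divides the supremum bound by \<epsilon>. This is where the dependence of the
  final constant on \<epsilon> enters.\<close>

lemma mollifier_bounded: "\<exists>M. \<forall>t. \<bar>mollifier \<eta> \<epsilon> t\<bar> \<le> M"
proof -
  obtain M where "\<And>t. \<bar>\<eta> t\<bar> \<le> M"
    using mollifier_kernel_bounded[OF \<eta>] by blast
  then have "\<bar>mollifier \<eta> \<epsilon> t\<bar> \<le> M / \<epsilon>" for t
    using \<epsilon> by (auto simp: mollifier_def abs_mult intro!: divide_right_mono)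
  then show ?thesis by blast
qed

lemma square_integrable_mollify_fun:
  assumes "integrable lborel f"
  shows "square_integrable (mollify_fun \<eta> \<epsilon> T f)"
proof -
  obtain M where M: "\<And>t. \<bar>mollifier \<eta> \<epsilon> t\<bar> \<le> M"
    using mollifier_bounded by blast
  show ?thesis
    unfolding mollify_fun_def
    by (rule square_integrable_truncate_convolution(1)[OF mollifier_measurable M
          integrable_truncate[OF assms] T])
qed

text \<open>The argument enters only under an integral, so changing it on a null set leaves the
  result equal at every point. This allows \<open>rep_L1 (v + w)\<close> to be replaced by the
  pointwise sum of representatives.\<close>

lemma mollify_fun_cong_AE:
  assumes "integrable lborel f" "integrable lborel g" "AE t in lborel. f t = g t"
  shows "mollify_fun \<eta> \<epsilon> T f = mollify_fun \<eta> \<epsilon> T g"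
proof -
  obtain M where M: "\<And>t. \<bar>mollifier \<eta> \<epsilon> t\<bar> \<le> M"
    using mollifier_bounded by blast
  note i = convolution_integrable[OF mollifier_measurable M integrable_truncate]
  have "convolution (mollifier \<eta> \<epsilon>) (truncate T f) = convolution (mollifier \<eta> \<epsilon>) (truncate T g)"
    unfolding convolution_def using assms
    by (intro ext integral_cong_AE borel_measurable_integrable i)
      (auto simp: truncate_def elim: eventually_mono)
  then show ?thesis by (simp add: mollify_fun_def)
qed

lemma mollify_fun_add:
  assumes "integrable lborel f" "integrable lborel g"
  shows "mollify_fun \<eta> \<epsilon> T (\<lambda>t. f t + g t) = (\<lambda>t. mollify_fun \<eta> \<epsilon> T f t + mollify_fun \<eta> \<epsilon> T g t)"
proof -
  obtain M where M: "\<And>t. \<bar>mollifier \<eta> \<epsilon> t\<bar> \<le> M"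
    using mollifier_bounded by blast
  note i = convolution_integrable[OF mollifier_measurable M integrable_truncate]
  show ?thesis
    using i[OF assms(1)] i[OF assms(2)]
    by (auto simp: mollify_fun_def truncate_def convolution_def distrib_left)
qed

text \<open>The scalar leaves the integral for every \<open>f\<close>: when the integrand is not
  integrable, both integrals take the default value 0 or \<open>c\<close> is 0.\<close>

lemma mollify_fun_cmult:
  "mollify_fun \<eta> \<epsilon> T (\<lambda>t. c * f t) = (\<lambda>t. c * mollify_fun \<eta> \<epsilon> T f t)"
  by (auto simp: mollify_fun_def truncate_def convolution_def mult.left_commute[of _ c])

lemma mollify_in_L2_on: "mollify \<eta> \<epsilon> T w \<in> L2_on T"
  using square_integrable_mollify_fun[OF integrable_rep_L1]
  unfolding mollify_def mollify_fun_def by (rule truncate_in_L2_on)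

lemma bounded_linear_mollify: "bounded_linear (mollify \<eta> \<epsilon> T)"
proof -
  obtain M where M: "\<And>t. \<bar>mollifier \<eta> \<epsilon> t\<bar> \<le> M"
    using mollifier_bounded by blast
  have M0: "M \<ge> 0"
    using order_trans[OF abs_ge_zero M] .
  note [simp] = integrable_rep_L1 square_integrable_mollify_fun
  show ?thesis
  proof (rule bounded_linear_intro[where K = "sqrt T * M"])
    fix v w :: L1 and c :: real
    have "mollify_fun \<eta> \<epsilon> T (rep_L1 (v + w)) = mollify_fun \<eta> \<epsilon> T (\<lambda>t. rep_L1 v t + rep_L1 w t)"
      by (intro mollify_fun_cong_AE rep_L1_add) auto
    then show "mollify \<eta> \<epsilon> T (v + w) = mollify \<eta> \<epsilon> T v + mollify \<eta> \<epsilon> T w"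
      by (simp add: mollify_def mollify_fun_add L2_class_add)
    have "mollify_fun \<eta> \<epsilon> T (rep_L1 (c *\<^sub>R w)) = mollify_fun \<eta> \<epsilon> T (\<lambda>t. c * rep_L1 w t)"
      by (intro mollify_fun_cong_AE rep_L1_scaleR) auto
    then show "mollify \<eta> \<epsilon> T (c *\<^sub>R w) = c *\<^sub>R mollify \<eta> \<epsilon> T w"
      by (simp add: mollify_def mollify_fun_cmult L2_class_scaleR)
    have "norm (mollify \<eta> \<epsilon> T w) \<le> sqrt T * M * (\<integral>t. \<bar>truncate T (rep_L1 w) t\<bar> \<partial>lborel)"
      unfolding mollify_def mollify_fun_def
      by (intro square_integrable_truncate_convolution mollifier_measurable M integrable_truncate T) auto
    \<comment> \<open>Truncation cannot increase the integral norm, so the bound holds on all of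
      \<open>L1\<close> and not just on \<open>L1_on T\<close>.\<close>
    also have "\<dots> \<le> sqrt T * M * (\<integral>t. \<bar>rep_L1 w t\<bar> \<partial>lborel)"
      using T M0 integrable_truncate[OF integrable_rep_L1[of w], of T]
      by (intro mult_left_mono integral_mono) (auto simp: truncate_def indicator_def)
    finally show "norm (mollify \<eta> \<epsilon> T w) \<le> norm w * (sqrt T * M)"
      by (simp add: norm_L1_rep mult.commute)
  qed
qed

end

section \<open>Second derivatives after composition with a bounded linear map\<close>

lemma has_second_derivative_on_compose_linear:
  fixes j :: "'b::real_normed_vector \<Rightarrow> real" and A :: "'a::real_normed_vector \<Rightarrow>\<^sub>L 'b"
  assumes j: "has_second_derivative_on j H S'" and A: "blinfun_apply A ` S \<subseteq> S'"
  obtains H' where "has_second_derivative_on (\<lambda>w. j (A w)) H' S"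
    and "\<And>w \<psi> \<phi>. H' w \<psi> \<phi> = H (A w) (A \<psi>) (A \<phi>)"
proof -
  from j obtain G where G: "\<And>w. w \<in> S' \<Longrightarrow> (j has_derivative blinfun_apply (G w)) (at w within S')"
      "\<And>w. w \<in> S' \<Longrightarrow> (G has_derivative blinfun_apply (H w)) (at w within S')"
    unfolding has_second_derivative_on_def by blast
  define H' where "H' w = Blinfun (\<lambda>h. H (A w) (A h) o\<^sub>L A)" for w
  \<comment> \<open>Precomposition with \<open>A\<close> is itself bounded and linear on the dual,
    so differentiation passes through it. The second derivative of the composite then has no term
    beyond the pullback of \<open>H\<close> in both arguments.\<close>
  have L: "bounded_linear (\<lambda>x::'b \<Rightarrow>\<^sub>L real. x o\<^sub>L A)"
    by (rule bounded_bilinear.bounded_linear_left[OF bounded_bilinear_blinfun_compose])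
  have H': "blinfun_apply (H' w) = (\<lambda>h. H (A w) (A h) o\<^sub>L A)" for w
    unfolding H'_def
    by (intro bounded_linear_Blinfun_apply bounded_linear_compose[OF L]
        bounded_linear_compose[OF blinfun.bounded_linear_right] blinfun.bounded_linear_right)
  have A': "(blinfun_apply A has_derivative blinfun_apply A) (at w within S)" for w
    by (rule bounded_linear_imp_has_derivative[OF blinfun.bounded_linear_right])
  \<comment> \<open>The codomain is arbitrary because the rule is used twice: for the real-valued
    \<open>j\<close> and for the dual-valued \<open>G\<close>. The inclusion of the image of
    \<open>S\<close> in \<open>S'\<close> lets the derivative within \<open>S'\<close> be restricted
    to that image.\<close>
  have chain: "((\<lambda>w. f (A w)) has_derivative (\<lambda>h. f' (A h))) (at w within S)"
    if "(f has_derivative f') (at (A w) within S')" for f :: "'b \<Rightarrow> 'c::real_normed_vector" and f' w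
    using diff_chain_within[OF A' has_derivative_subset[OF that A]] by (simp add: o_def)
  have "has_second_derivative_on (\<lambda>w. j (A w)) H' S"
    unfolding has_second_derivative_on_def
  proof (intro exI[of _ "\<lambda>w. G (A w) o\<^sub>L A"] ballI conjI)
    fix w assume "w \<in> S"
    then have w: "A w \<in> S'" using A by blast
    show "((\<lambda>w. j (A w)) has_derivative blinfun_apply (G (A w) o\<^sub>L A)) (at w within S)"
      using chain[OF G(1)[OF w]] by (simp add: blinfun_apply_blinfun_compose[abs_def])
    show "((\<lambda>w. G (A w) o\<^sub>L A) has_derivative blinfun_apply (H' w)) (at w within S)"
      unfolding H' by (rule bounded_linear.has_derivative[OF L chain[OF G(2)[OF w]]])
  qed
  then show ?thesis
    using that by (simp add: H')
qed

theorem proposition4p5: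
  fixes \<eta> :: "real \<Rightarrow> real" and T \<epsilon> :: real
  assumes "mollifier_kernel \<eta>" and "T > 0" and "\<epsilon> > 0"
  shows "(\<forall>w\<in>L1_on T. square_integrable (mollify_fun \<eta> \<epsilon> T (rep_L1 w))) \<and>
    bounded_linear (mollify \<eta> \<epsilon> T) \<and> mollify \<eta> \<epsilon> T ` L1_on T \<subseteq> L2_on T \<and>
    (\<forall>(j :: L2 \<Rightarrow> real) D2j C.
      has_second_derivative_on j D2j (L2_on T) \<and> C > 0 \<and>
      (\<forall>w\<in>L2_on T. \<forall>\<psi>\<in>L2_on T. \<forall>\<phi>\<in>L2_on T.
         \<bar>D2j w \<psi> \<phi>\<bar> \<le> C * norm \<psi> * norm \<phi>) \<longrightarrow>
      (\<exists>D2j\<epsilon>. has_second_derivative_on (\<lambda>w. j (mollify \<eta> \<epsilon> T (L2_to_L1 T w))) D2j\<epsilon> (L2_on T) \<and>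
        (\<exists>C\<epsilon>>0. \<forall>w\<in>L2_on T. \<forall>\<psi>\<in>L2_on T. \<forall>\<phi>\<in>L2_on T.
           \<bar>D2j\<epsilon> w \<psi> \<phi>\<bar> \<le> C\<epsilon> * norm (L2_to_L1 T \<psi>) * norm (L2_to_L1 T \<phi>))))"
proof (intro conjI allI impI)
  have T: "T \<ge> 0" using assms by simp
  note K = bounded_linear_mollify[OF assms(1) T assms(3)]
  note in_L2 = mollify_in_L2_on[OF assms(1) T assms(3)]
  \<comment> \<open>This ensures that \<open>mollify\<close> forms the class of a function in the
    domain of the partial quotient, where \<open>L2_class\<close> has its intended meaning.\<close>
  show "\<forall>w\<in>L1_on T. square_integrable (mollify_fun \<eta> \<epsilon> T (rep_L1 w))"
    by (intro ballI square_integrable_mollify_fun assms T integrable_rep_L1)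
  show "bounded_linear (mollify \<eta> \<epsilon> T)"
    by (rule K)
  show "mollify \<eta> \<epsilon> T ` L1_on T \<subseteq> L2_on T"
    using in_L2 by blast
  fix j :: "L2 \<Rightarrow> real" and D2j C
  assume "has_second_derivative_on j D2j (L2_on T) \<and> C > 0 \<and>
    (\<forall>w\<in>L2_on T. \<forall>\<psi>\<in>L2_on T. \<forall>\<phi>\<in>L2_on T. \<bar>D2j w \<psi> \<phi>\<bar> \<le> C * norm \<psi> * norm \<phi>)"
  then have j: "has_second_derivative_on j D2j (L2_on T)" and C: "C > 0"
    and bound: "\<And>w \<psi> \<phi>. w \<in> L2_on T \<Longrightarrow> \<psi> \<in> L2_on T \<Longrightarrow> \<phi> \<in> L2_on T \<Longrightarrow>
      \<bar>D2j w \<psi> \<phi>\<bar> \<le> C * norm \<psi> * norm \<phi>"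
    by blast+
  define A where "A = Blinfun (\<lambda>w. mollify \<eta> \<epsilon> T (L2_to_L1 T w))"
  have A: "blinfun_apply A = (\<lambda>w. mollify \<eta> \<epsilon> T (L2_to_L1 T w))"
    unfolding A_def
    by (intro bounded_linear_Blinfun_apply bounded_linear_compose[OF K] bounded_linear_L2_to_L1 T)
  have "blinfun_apply A ` L2_on T \<subseteq> L2_on T"
    using in_L2 by (auto simp: A)
  from has_second_derivative_on_compose_linear[OF j this] obtain D2j\<epsilon> where
    D2: "has_second_derivative_on (\<lambda>w. j (A w)) D2j\<epsilon> (L2_on T)"
    and eq: "\<And>w \<psi> \<phi>. D2j\<epsilon> w \<psi> \<phi> = D2j (A w) (A \<psi>) (A \<phi>)"
    by blast
  \<comment> \<open>The bound is taken for \<open>mollify\<close> alone rather than for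
    \<open>A\<close>: keeping the inclusion inside the norm leaves the weaker \<open>L1\<close>
    norms of \<psi> and \<phi> on the right-hand side.\<close>
  obtain N where N: "N > 0" "\<And>v. norm (mollify \<eta> \<epsilon> T v) \<le> norm v * N"
    using bounded_linear.pos_bounded[OF K] by blast
  have "\<bar>D2j\<epsilon> w \<psi> \<phi>\<bar> \<le> C * N\<^sup>2 * norm (L2_to_L1 T \<psi>) * norm (L2_to_L1 T \<phi>)" for w \<psi> \<phi>
  proof -
    have "\<bar>D2j\<epsilon> w \<psi> \<phi>\<bar> \<le> C * norm (A \<psi>) * norm (A \<phi>)"
      \<comment> \<open>The bound on \<open>D2j\<close> applies because every value of
        \<open>A\<close> lies in \<open>L2_on T\<close>, by the outer truncation in the
        mollification.\<close>
      unfolding eq by (intro bound) (simp_all add: A in_L2)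
    also have "\<dots> \<le> C * (norm (L2_to_L1 T \<psi>) * N) * (norm (L2_to_L1 T \<phi>) * N)"
      using C N by (intro mult_mono) (auto simp: A)
    finally show ?thesis
      by (simp add: power2_eq_square mult_ac)
  qed
  then show "\<exists>D2j\<epsilon>. has_second_derivative_on (\<lambda>w. j (mollify \<eta> \<epsilon> T (L2_to_L1 T w))) D2j\<epsilon> (L2_on T) \<and>
      (\<exists>C\<epsilon>>0. \<forall>w\<in>L2_on T. \<forall>\<psi>\<in>L2_on T. \<forall>\<phi>\<in>L2_on T.
         \<bar>D2j\<epsilon> w \<psi> \<phi>\<bar> \<le> C\<epsilon> * norm (L2_to_L1 T \<psi>) * norm (L2_to_L1 T \<phi>))"
    using D2 C N(1) unfolding A
    by (intro exI[of _ D2j\<epsilon>] conjI exI[of _ "C * N\<^sup>2"]) auto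
qed

end
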